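(* Let $\beta\ge\beta_c$. Then $$U_{\min}=\begin{cases}\dfrac{\beta^2}2+\dfrac12\log\dfrac2p+\dfrac{p-2}{8p}\Big(4+\dfrac{\beta^2}{\tilde\beta_c^2}\,\dfrac{p-2}{p-1}\Big)&\text{if }\beta_c\le\beta\le\tilde\beta_c,\\[3mm]\dfrac{\beta^2}2+\dfrac12\log(1-q)+\dfrac{q\,(3p(1-q)+3q-4)}{2p(p-1)(1-q)^2}&\text{if }\beta\ge\tilde\beta_c,\end{cases}$$ where in the second case $q$ is the unique solution of $(1-q)q^{\frac{p-2}2}=\frac1{\beta\sqrt{p(p-1)}}$ in $[\frac{p-2}p,1)$. Moreover $$U_{\max}=\frac{\beta^2}2+\frac12\log(1-q)+\frac2p\,\frac q{1-q}\,\frac{E_0}{E_\infty}\,\bar r-\frac12\,\frac{p+\frac q{1-q}}{p(p-1)}\,\frac q{1-q}\,\bar r^2,$$ where $q$ is the unique solution of $(1-q)q^{\frac{p-2}2}=\frac{\bar r}{\beta\sqrt{p(p-1)}}$ in $[\frac{p-2}p,1)$; alternatively $$U_{\max}=\sup_{q\in[\frac{p-2}p,1):\ \sqrt2\beta_2(q)\le1}h_{\mathrm{TAP}}(q^{p/2}E_0,q).$$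
   Context: Fix an integer $p\ge3$. $E_\infty=2\sqrt{(p-1)/p}$. For $\eta\ge1$ let $\Omega(\eta)=\eta^2-\frac12-\eta\sqrt{\eta^2-1}+\log(\eta+\sqrt{\eta^2-1})$ and $g(\eta)=\frac12+\frac12\log(p-1)-2\frac{p-1}{p}\eta^2+\Omega(\eta)$; $E_0>E_\infty$ is the unique zero of the strictly decreasing function $E\mapsto g(E/E_\infty)$ on $[E_\infty,\infty)$. $r_-(x)=x-\sqrt{x^2-1}$ ($x\ge1$), $\bar r=r_-(E_0/E_\infty)$, $\tilde\beta_c=\frac12\sqrt{\frac{p^{p-1}}{(p-1)(p-2)^{p-2}}}$, $\beta_c=\bar r\tilde\beta_c<\tilde\beta_c$. $\beta_2(q)=\beta\sqrt{\frac{p(p-1)}2}(1-q)q^{\frac{p-2}2}$, $h_{\mathrm{TAP}}(E,q)=\beta E+\frac12\log(1-q)+\frac{\beta^2}2\big(1-p(1-q)q^{p-1}-q^p\big)$, $f(E,q)=h_{\mathrm{TAP}}(q^{p/2}E,q)$. $E_{\min}=\frac{E_\infty}2\big(\frac{\tilde\beta_c}\beta+\frac\beta{\tilde\beta_c}\big)$ if $\beta\le\tilde\beta_c$ and $E_{\min}=E_\infty$ if $\beta\ge\tilde\beta_c$. For $E\ge E_{\min}$, $q_E(E)$ is the unique solution of $\sqrt2\beta_2(q)=r_-(E/E_\infty)$ in $[\frac{p-2}p,1)$. By definition $U_{\min}=f(E_{\min},q_E(E_{\min}))$ and, for $\beta\ge\beta_c$ (equivalently $E_{\min}\le E_0$),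 $U_{\max}=f(E_0,q_E(E_0))$. *)

theory Defs
  imports "HOL-Analysis.Analysis"
begin

text \<open>
  The integer \<open>p \<ge> 3\<close> and the inverse temperature \<open>\<beta>\<close> are explicit arguments throughout. Half-integer
  powers are written with \<open>powr\<close>; they are only used at positive bases, since
  \<open>q \<ge> (p - 2) / p > 0\<close>. As \<open>p\<close> is a natural number, differences in base position are formed in
  the reals.
\<close>

definition E_inf :: "nat \<Rightarrow> real" where
  "E_inf p = 2 * sqrt ((real p - 1) / real p)"

definition Omega :: "real \<Rightarrow> real" where
  "Omega \<eta> = \<eta>\<^sup>2 - 1 / 2 - \<eta> * sqrt (\<eta>\<^sup>2 - 1) + ln (\<eta> + sqrt (\<eta>\<^sup>2 - 1))"

definition g :: "nat \<Rightarrow> real \<Rightarrow> real" where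
  "g p \<eta> = 1 / 2 + 1 / 2 * ln (real p - 1) - 2 * ((real p - 1) / real p) * \<eta>\<^sup>2 + Omega \<eta>"

definition E_0 :: "nat \<Rightarrow> real" where
  "E_0 p = (THE E. E \<in> {E_inf p..} \<and> g p (E / E_inf p) = 0)"

definition r_minus :: "real \<Rightarrow> real" where
  "r_minus x = x - sqrt (x\<^sup>2 - 1)"

definition r_bar :: "nat \<Rightarrow> real" where
  "r_bar p = r_minus (E_0 p / E_inf p)"

text \<open>The critical value \<open>\<beta>\<^sub>c\<close> carrying a tilde, \<open>beta_c_tilde\<close>, is larger than \<open>beta_c\<close>.\<close>

definition beta_c_tilde :: "nat \<Rightarrow> real" where
  "beta_c_tilde p =
     1 / 2 * sqrt (real p ^ (p - 1) / ((real p - 1) * (real p - 2) ^ (p - 2)))"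

definition beta_c :: "nat \<Rightarrow> real" where
  "beta_c p = r_bar p * beta_c_tilde p"

definition beta_2 :: "nat \<Rightarrow> real \<Rightarrow> real \<Rightarrow> real" where
  "beta_2 p \<beta> q =
     \<beta> * sqrt (real p * (real p - 1) / 2) * (1 - q) * q powr ((real p - 2) / 2)"

definition h_TAP :: "nat \<Rightarrow> real \<Rightarrow> real \<Rightarrow> real \<Rightarrow> real" where
  "h_TAP p \<beta> E q =
     \<beta> * E + 1 / 2 * ln (1 - q) + \<beta>\<^sup>2 / 2 * (1 - real p * (1 - q) * q ^ (p - 1) - q ^ p)"

definition f_TAP :: "nat \<Rightarrow> real \<Rightarrow> real \<Rightarrow> real \<Rightarrow> real" where
  "f_TAP p \<beta> E q = h_TAP p \<beta> (q powr (real p / 2) * E) q"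

definition E_min :: "nat \<Rightarrow> real \<Rightarrow> real" where
  "E_min p \<beta> =
     (if \<beta> \<le> beta_c_tilde p
      then E_inf p / 2 * (beta_c_tilde p / \<beta> + \<beta> / beta_c_tilde p)
      else E_inf p)"

definition q_range :: "nat \<Rightarrow> real set" where
  "q_range p = {(real p - 2) / real p..<1}"

text \<open>Only meaningful for \<open>E \<ge> E_min p \<beta>\<close>, where the solution exists and is unique.\<close>

definition q_E :: "nat \<Rightarrow> real \<Rightarrow> real \<Rightarrow> real" where
  "q_E p \<beta> E = (THE q. q \<in> q_range p \<and> sqrt 2 * beta_2 p \<beta> q = r_minus (E / E_inf p))"

definition U_min :: "nat \<Rightarrow> real \<Rightarrow> real" where
  "U_min p \<beta> = f_TAP p \<beta> (E_min p \<beta>) (q_E p \<beta> (E_min p \<beta>))"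

text \<open>Only meaningful for \<open>\<beta> \<ge> beta_c p\<close>, equivalently \<open>E_min p \<beta> \<le> E_0 p\<close>.\<close>

definition U_max :: "nat \<Rightarrow> real \<Rightarrow> real" where
  "U_max p \<beta> = f_TAP p \<beta> (E_0 p) (q_E p \<beta> (E_0 p))"

end

theory Submission
  imports Defs
begin

text \<open>
  Put \<open>z(q) = \<surd>2 \<beta>\<^sub>2(q)\<close> and \<open>\<eta> = E / E\<^sub>\<infinity>\<close>. On \<open>[(p - 2) / p, 1)\<close> the function \<open>z\<close> decreases strictly
  from \<open>\<beta> / beta_c_tilde p\<close> to the limit 0, so \<open>q\<^sub>E\<close> is well defined; eliminating \<open>\<beta>\<close> in favour of
  \<open>z\<close> gives the closed forms. Moreover
  \<open>\<partial>\<^sub>q h\<^sub>T\<^sub>A\<^sub>P (q\<^bsup>p/2\<^esup> E, q) = - (z\<^sup>2 - 2 \<eta> z + 1) / (2 (1 - q))\<close>, and the quadratic has the roots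
  \<open>r\<^sub>-(\<eta>) \<le> 1 \<le> 1 / r\<^sub>-(\<eta>)\<close>. On the region \<open>z \<le> 1\<close> the function therefore increases up to
  the point where \<open>z = r\<^sub>-(\<eta>)\<close>, which is \<open>q\<^sub>E(E)\<close>, and decreases afterwards.
\<close>

section \<open>A logarithm bound and elementary properties of \<open>r_minus\<close>\<close>

text \<open>At \<open>x = p - 1\<close> this is exactly the inequality behind
  \<open>g p 1 > 0\<close>. The difference of the two sides vanishes at 1 and its derivative is a
  square over a positive quantity. That derivative is 0 at 1, hence the mean value rule on the open
  interval.\<close>

lemma ln_gt_pade:
  fixes x :: real
  assumes "x > 1"
  shows "ln x > 2 * (x - 1) / (x + 1)"
proof -
  let ?h = "\<lambda>x::real. ln x - 2 * (x - 1) / (x + 1)"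
  have "?h 1 < ?h x"
  proof (rule DERIV_pos_imp_increasing_open[OF assms])
    fix y :: real
    assume y: "1 < y" "y < x"
    have "(?h has_real_derivative (y - 1)\<^sup>2 / (y * (y + 1)\<^sup>2)) (at y)"
      using y by (auto intro!: derivative_eq_intros)
        (simp add: divide_simps, simp add: algebra_simps power2_eq_square)
    moreover have "(y - 1)\<^sup>2 / (y * (y + 1)\<^sup>2) > 0"
      using y by simp
    ultimately show "\<exists>d. (?h has_real_derivative d) (at y) \<and> d > 0"
      by blast
  qed (auto intro!: continuous_intros)
  then show ?thesis by simp
qed

lemma r_minus_pos: "x \<ge> 1 \<Longrightarrow> r_minus x > 0"
  using real_sqrt_less_mono[of "x\<^sup>2 - 1" "x\<^sup>2"] by (simp add: r_minus_def)

lemma r_minus_less_1: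
  assumes "x > 1"
  shows "r_minus x < 1"
proof -
  have "(x - 1)\<^sup>2 < x\<^sup>2 - 1"
    using assms by (simp add: power2_eq_square algebra_simps)
  then have "x - 1 < sqrt (x\<^sup>2 - 1)"
    by (rule real_less_rsqrt)
  then show ?thesis by (simp add: r_minus_def)
qed

text \<open>Later this eliminates \<eta> from the derivative of \<open>f_TAP\<close>. The two roots
  of the quadratic have product 1.\<close>

lemma r_minus_quadratic: "x \<ge> 1 \<Longrightarrow> (r_minus x)\<^sup>2 - 2 * x * r_minus x + 1 = 0"
  by (simp add: r_minus_def power2_diff algebra_simps) (simp add: power2_eq_square)

text \<open>For \<beta> up to \<open>beta_c_tilde p\<close>, the ratio
  \<open>E_min p \<beta> / E_inf p\<close> is the Joukowsky map at
  \<open>\<beta> / beta_c_tilde p\<close>, and \<open>r_minus\<close> inverts this map. The bound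
  \<open>r \<le> 1\<close> selects the branch of the square root.\<close>

lemma r_minus_joukowsky:
  assumes "0 < r" "r \<le> 1"
  shows "r_minus ((1 / r + r) / 2) = r"
proof -
  have "((1 / r + r) / 2)\<^sup>2 - 1 = ((1 / r - r) / 2)\<^sup>2"
    using assms by (simp add: field_simps power2_eq_square)
  moreover have "1 / r - r \<ge> 0"
    using assms mult_le_one[of r r] by (simp add: field_simps)
  ultimately show ?thesis
    by (simp add: r_minus_def) (simp add: field_simps)
qed

section \<open>Monotonicity of \<open>g\<close> and its zero, which defines
  \<open>E_0\<close>\<close>

lemma E_inf_pos: "p \<ge> 3 \<Longrightarrow> E_inf p > 0"
  by (simp add: E_inf_def)

text \<open>Since \<open>Omega 1 = 1 / 2\<close>, the value is half the gap in
  \<open>ln_gt_pade\<close> at \<open>p - 1\<close>.\<close>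

lemma g_1_pos:
  assumes "p \<ge> 3"
  shows "g p 1 > 0"
proof -
  have "ln (real p - 1) > 2 * (real p - 2) / real p"
    using ln_gt_pade[of "real p - 1"] assms by simp
  then show ?thesis
    using assms by (simp add: g_def Omega_def field_simps)
qed

lemma continuous_on_g: "continuous_on {1..} (g p)"
proof -
  have "\<eta> + sqrt (\<eta>\<^sup>2 - 1) \<noteq> 0" if "\<eta> \<ge> 1" for \<eta> :: real
    using that by (smt (verit) one_le_power real_sqrt_ge_zero)
  then show ?thesis
    unfolding g_def Omega_def by (intro continuous_intros) auto
qed

text \<open>With \<open>s = sqrt (x\<^sup>2 - 1)\<close>, the product \<open>x * s\<close> has
  derivative \<open>2 * s + 1 / s\<close> and the logarithm has derivative \<open>1 / s\<close>, so
  the singular terms cancel. The result is \<open>2 * r_minus x\<close>.\<close>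

lemma Omega_deriv:
  assumes x: "x > 1"
  shows "(Omega has_real_derivative 2 * x - 2 * sqrt (x\<^sup>2 - 1)) (at x)"
proof -
  define s where "s = sqrt (x\<^sup>2 - 1)"
  have x2: "x\<^sup>2 > 1" using x by (simp add: one_less_power)
  have s: "s > 0" "s\<^sup>2 = x\<^sup>2 - 1"
    unfolding s_def using x2 by (auto intro!: real_sqrt_pow2)
  have "((\<lambda>\<eta>. \<eta>\<^sup>2 - 1) has_real_derivative 2 * x) (at x)"
    by (auto intro!: derivative_eq_intros)
  moreover have "x\<^sup>2 - 1 > 0" using x2 by (simp only: diff_gt_0_iff_gt)
  ultimately have "((\<lambda>\<eta>. sqrt (\<eta>\<^sup>2 - 1)) has_real_derivative inverse (sqrt (x\<^sup>2 - 1)) / 2 * (2 * x)) (at x)"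
    by (intro DERIV_chain2[where f = sqrt] DERIV_real_sqrt)
  moreover have "inverse (sqrt (x\<^sup>2 - 1)) / 2 * (2 * x) = x / s"
    unfolding s_def[symmetric] using s(1) by (simp add: field_simps)
  ultimately have t: "((\<lambda>\<eta>. sqrt (\<eta>\<^sup>2 - 1)) has_real_derivative x / s) (at x)"
    by (simp only:)
  have pos: "x + sqrt (x\<^sup>2 - 1) > 0" using s(1) x unfolding s_def by linarith
  have A: "((\<lambda>\<eta>. \<eta> * sqrt (\<eta>\<^sup>2 - 1)) has_real_derivative x * (x / s) + 1 * sqrt (x\<^sup>2 - 1)) (at x)"
    by (rule DERIV_mult'[OF DERIV_ident t])
  have "((\<lambda>\<eta>. \<eta> + sqrt (\<eta>\<^sup>2 - 1)) has_real_derivative 1 + x / s) (at x)"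
    by (rule DERIV_add[OF DERIV_ident t])
  then have B: "((\<lambda>\<eta>. ln (\<eta> + sqrt (\<eta>\<^sup>2 - 1))) has_real_derivative
      inverse (x + sqrt (x\<^sup>2 - 1)) * (1 + x / s)) (at x)"
    using pos by (intro DERIV_chain2[where f = ln] DERIV_ln)
  have C: "((\<lambda>\<eta>. \<eta>\<^sup>2 - 1 / 2) has_real_derivative 2 * x) (at x)"
    using DERIV_diff[OF DERIV_pow[of 2 x] DERIV_const[of "1 / 2"]] by simp
  have D: "((\<lambda>\<eta>. \<eta>\<^sup>2 - 1 / 2 - \<eta> * sqrt (\<eta>\<^sup>2 - 1) + ln (\<eta> + sqrt (\<eta>\<^sup>2 - 1))) has_real_derivative
      2 * x - (x * (x / s) + 1 * sqrt (x\<^sup>2 - 1)) + inverse (x + sqrt (x\<^sup>2 - 1)) * (1 + x / s)) (at x)"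
    by (rule DERIV_add[OF DERIV_diff[OF C A] B])
  have "inverse (x + s) * (1 + x / s) = 1 / s"
    using s x by (simp add: field_simps)
  moreover have "x * (x / s) + 1 * s = 2 * s + 1 / s"
    using s by (simp add: field_simps power2_eq_square)
  ultimately have "2 * x - (x * (x / s) + 1 * s) + inverse (x + s) * (1 + x / s) = 2 * x - 2 * s"
    by simp
  then show ?thesis
    unfolding Omega_def[abs_def] using DERIV_cong[OF D] by (simp only: s_def)
qed

lemma g_strict_decreasing:
  assumes p: "p \<ge> 3" and ab: "1 \<le> a" "a < b"
  shows "g p b < g p a"
proof (rule DERIV_neg_imp_decreasing_open[OF ab(2)])
  show "continuous_on {a..b} (g p)"
    by (rule continuous_on_subset[OF continuous_on_g]) (use ab in auto)
  fix x :: real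
  assume x: "a < x" "x < b"
  define s where "s = sqrt (x\<^sup>2 - 1)"
  have x1: "x > 1" using x ab by simp
  then have s: "s > 0" by (simp add: s_def one_less_power)
  have "(Omega has_real_derivative 2 * x - 2 * s) (at x)"
    unfolding s_def by (rule Omega_deriv[OF x1])
  moreover have "((\<lambda>\<eta>. k - 2 * c * \<eta>\<^sup>2) has_real_derivative - 4 * c * x) (at x)" for k c
    by (auto intro!: derivative_eq_intros)
  ultimately have "(g p has_real_derivative - 4 * ((real p - 1) / real p) * x + (2 * x - 2 * s)) (at x)"
    unfolding g_def[abs_def] by (intro DERIV_add)
  moreover have "- 4 * ((real p - 1) / real p) * x + (2 * x - 2 * s) < 0"
  proof -
    define c where "c = (real p - 1) / real p"
    \<comment> \<open>Thus the quadratic term of \<open>g\<close> absorbs the \<open>2 * x\<close>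
      coming from \<open>Omega\<close>, and at most \<open>- 2 * s < 0\<close> remains.\<close>
    have "1 / 2 \<le> c" using p by (simp add: c_def field_simps)
    then have "1 / 2 * x \<le> c * x"
      using x1 by (intro mult_right_mono) auto
    moreover have "- 4 * c * x = - 4 * (c * x)" by simp
    ultimately show ?thesis unfolding c_def[symmetric] using s by linarith
  qed
  ultimately show "\<exists>d. (g p has_real_derivative d) (at x) \<and> d < 0"
    by blast
qed

lemma g_nonpos_somewhere:
  assumes "p \<ge> 3"
  shows "\<exists>\<eta>\<ge>1. g p \<eta> \<le> 0"
proof -
  \<comment> \<open>At this witness the fraction \<open>(p - 1) / p\<close> clears. After the linear
    bounds on both logarithms, the term \<open>- 2 * \<eta>\<^sup>2\<close> dominates everything of
    first order.\<close>
  define \<eta> where "\<eta> = real p"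
  have \<eta>: "\<eta> \<ge> 3" using assms by (simp add: \<eta>_def)
  define s where "s = sqrt (\<eta>\<^sup>2 - 1)"
  have s: "0 \<le> s" "s < \<eta>"
    using r_minus_pos[of \<eta>] \<eta> by (simp_all add: s_def r_minus_def one_le_power)
  have s2: "s\<^sup>2 = \<eta>\<^sup>2 - 1" using \<eta> by (simp add: s_def one_le_power)
  have "ln (\<eta> + s) \<le> \<eta> + s - 1"
    using s \<eta> by (intro ln_le_minus_one) auto
  moreover have "ln (\<eta> - 1) \<le> \<eta> - 2"
    using ln_le_minus_one[of "\<eta> - 1"] \<eta> by simp
  moreover have "\<eta> * s \<ge> s\<^sup>2"
    using s by (simp add: power2_eq_square mult_right_mono)
  moreover have "2 * ((\<eta> - 1) / \<eta>) * \<eta>\<^sup>2 = 2 * \<eta>\<^sup>2 - 2 * \<eta>"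
    using \<eta> by (simp add: field_simps power2_eq_square)
  moreover have "\<eta>\<^sup>2 \<ge> 3 * \<eta>" using \<eta> by (simp add: power2_eq_square)
  ultimately have "g p \<eta> \<le> 0"
    unfolding g_def Omega_def \<eta>_def[symmetric] s_def[symmetric]
    using s s2 \<eta> by linarith
  then show ?thesis using \<eta> by (intro exI[of _ \<eta>]) simp
qed

text \<open>A zero of \<open>g p\<close> exists by the intermediate value theorem, differs from 1
  because \<open>g p 1 > 0\<close>, and is unique by strict monotonicity. So the description in
  \<open>E_0\<close> is proper.\<close>

lemma E_0_gt_E_inf:
  assumes p: "p \<ge> 3"
  shows "E_0 p > E_inf p"
proof -
  obtain b where b: "b \<ge> 1" "g p b \<le> 0" using g_nonpos_somewhere[OF p] by auto
  have "\<exists>\<eta>. 1 \<le> \<eta> \<and> \<eta> \<le> b \<and> g p \<eta> = 0"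
    by (rule IVT2') (use b g_1_pos[OF p] continuous_on_subset[OF continuous_on_g] in auto)
  then obtain \<eta> where \<eta>: "\<eta> \<ge> 1" "g p \<eta> = 0" by blast
  then have \<eta>1: "\<eta> > 1" using g_1_pos[OF p] by (cases "\<eta> = 1") auto
  note E = E_inf_pos[OF p]
  have "E_0 p = \<eta> * E_inf p"
    unfolding E_0_def
  proof (rule the_equality)
    show "\<eta> * E_inf p \<in> {E_inf p..} \<and> g p (\<eta> * E_inf p / E_inf p) = 0"
      using \<eta> E by simp
  next
    fix x assume x: "x \<in> {E_inf p..} \<and> g p (x / E_inf p) = 0"
    then have "x / E_inf p \<ge> 1" using E by simp
    then have "x / E_inf p = \<eta>"
      using x \<eta> g_strict_decreasing[OF p] by (metis less_irrefl linorder_less_linear)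
    then show "x = \<eta> * E_inf p" using E by (simp add: field_simps)
  qed
  then show ?thesis using \<eta>1 E by simp
qed

section \<open>The equation that determines q, and \<open>q_E\<close>\<close>

text \<open>This is the \<beta>-free factor of \<open>z(q)\<close> and the left side of the
  equations for q in the theorem.\<close>

definition \<phi> :: "nat \<Rightarrow> real \<Rightarrow> real" where
  "\<phi> p q = (1 - q) * q powr ((real p - 2) / 2)"

text \<open>Links the half-integer powers in \<open>beta_2\<close> to the natural powers in
  \<open>h_TAP\<close>.\<close>

lemma powr_half_square:
  assumes "p \<ge> 2" "q > 0"
  shows "(q powr ((real p - 2) / 2))\<^sup>2 = q ^ (p - 2)"
proof -
  have "(q powr ((real p - 2) / 2))\<^sup>2 = q powr ((real p - 2) / 2 + (real p - 2) / 2)"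
    by (simp only: powr_add power2_eq_square)
  also have "(real p - 2) / 2 + (real p - 2) / 2 = real (p - 2)"
    using assms by (simp add: of_nat_diff)
  finally show ?thesis
    using assms by (simp only: powr_realpow)
qed

lemma powr_half_Suc:
  assumes "q > 0"
  shows "q powr (real p / 2) = q * q powr ((real p - 2) / 2)"
  using assms by (simp add: powr_mult_base diff_divide_distrib)

lemma sqrt_2_beta_2: "sqrt 2 * beta_2 p \<beta> q = \<beta> * sqrt (real p * (real p - 1)) * \<phi> p q"
  by (simp add: beta_2_def \<phi>_def real_sqrt_divide)

lemma continuous_on_\<phi>: "continuous_on {0<..} (\<phi> p)"
  unfolding \<phi>_def by (intro continuous_intros) auto

text \<open>The derivative has the sign of \<open>p - 2 - p * q\<close>: the left end of
  \<open>q_range\<close> is the critical point of \<open>\<phi> p\<close>, where the derivative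
  vanishes, so only interior points are differentiated.\<close>

lemma \<phi>_strict_decreasing:
  assumes p: "p \<ge> 3" and ab: "(real p - 2) / real p \<le> a" "a < b" "b \<le> 1"
  shows "\<phi> p b < \<phi> p a"
proof (rule DERIV_neg_imp_decreasing_open[OF ab(2)])
  have q0: "(real p - 2) / real p > 0" using p by simp
  show "continuous_on {a..b} (\<phi> p)"
    by (rule continuous_on_subset[OF continuous_on_\<phi>]) (use ab q0 in auto)
  fix q assume q: "a < q" "q < b"
  then have "(real p - 2) / real p < q" using ab by linarith
  then have q1: "q > 0" "real p - 2 < real p * q"
    using q0 p by (linarith, simp add: pos_divide_less_eq mult.commute)
  let ?w = "q powr ((real p - 2) / 2)"
  have "(\<phi> p has_real_derivative ?w / (2 * q) * (real p - 2 - real p * q)) (at q)"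
    unfolding \<phi>_def[abs_def] using q1
    by (auto intro!: derivative_eq_intros simp: powr_diff) (simp add: field_simps)
  moreover have "?w / (2 * q) * (real p - 2 - real p * q) < 0"
    using q1 by (intro mult_pos_neg) auto
  ultimately show "\<exists>d. (\<phi> p has_real_derivative d) (at q) \<and> d < 0"
    by blast
qed

lemma beta_c_tilde_pos: "p \<ge> 3 \<Longrightarrow> beta_c_tilde p > 0"
  by (simp add: beta_c_tilde_def)

text \<open>This explains the formula for \<open>beta_c_tilde\<close>: at that \<beta>, the largest
  value of z on \<open>q_range\<close> is 1. Both sides are nonnegative, so comparing squares
  removes the half-integer powers.\<close>

lemma sqrt_\<phi>_left_end:
  assumes p: "p \<ge> 3"
  shows "sqrt (real p * (real p - 1)) * \<phi> p ((real p - 2) / real p) = 1 / beta_c_tilde p"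
proof (rule power2_eq_imp_eq)
  define k where "k = p - 2"
  have k: "p - 1 = Suc k" "p - 2 = k" using p by (simp_all add: k_def)
  have P: "real p > 2" using p by simp
  have "1 - (real p - 2) / real p = 2 / real p" using P by (simp add: field_simps)
  then have \<phi>2: "(\<phi> p ((real p - 2) / real p))\<^sup>2 = (2 / real p)\<^sup>2 * ((real p - 2) / real p) ^ k"
    using p powr_half_square[of p "(real p - 2) / real p"]
    by (simp add: \<phi>_def power_mult_distrib power_divide k)
  have "(sqrt (real p * (real p - 1)) * \<phi> p ((real p - 2) / real p))\<^sup>2 =
      real p * (real p - 1) * ((2 / real p)\<^sup>2 * ((real p - 2) / real p) ^ k)"
    using P by (simp add: power_mult_distrib \<phi>2)
  also have "\<dots> = 4 * ((real p - 1) * (real p - 2) ^ k) / (real p * real p ^ k)"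
    using P by (simp add: power_divide power2_eq_square)
  also have "\<dots> = (1 / beta_c_tilde p)\<^sup>2"
    unfolding beta_c_tilde_def k using P by (simp add: power_mult_distrib power_divide)
  finally show "(sqrt (real p * (real p - 1)) * \<phi> p ((real p - 2) / real p))\<^sup>2 =
      (1 / beta_c_tilde p)\<^sup>2" .
  show "0 \<le> 1 / beta_c_tilde p" using beta_c_tilde_pos[OF p] by simp
  show "0 \<le> sqrt (real p * (real p - 1)) * \<phi> p ((real p - 2) / real p)"
    using p by (simp add: \<phi>_def)
qed

text \<open>The upper bound on r says that the target value does not exceed \<open>\<phi> p\<close>
  at the left end, while \<open>\<phi> p 1 = 0\<close> lies below it. Continuity gives a solution
  and strict monotonicity its uniqueness; \<open>r > 0\<close> excludes
  \<open>q = 1\<close>.\<close>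

lemma ex1_\<phi>_eq:
  assumes p: "p \<ge> 3" and \<beta>: "\<beta> > 0" and r: "0 < r" "r \<le> \<beta> / beta_c_tilde p"
  shows "\<exists>!q. q \<in> q_range p \<and> \<phi> p q = r / (\<beta> * sqrt (real p * (real p - 1)))"
proof -
  let ?q0 = "(real p - 2) / real p" and ?K = "\<beta> * sqrt (real p * (real p - 1))"
  have q0: "?q0 > 0" "?q0 < 1" using p by simp_all
  have K: "?K > 0" using p \<beta> by simp
  have "?K * \<phi> p ?q0 = \<beta> / beta_c_tilde p"
    using sqrt_\<phi>_left_end[OF p] by (simp add: mult.assoc)
  then have "r / ?K \<le> \<phi> p ?q0" using r K by (simp add: pos_divide_le_eq mult.commute)
  moreover have "\<phi> p 1 \<le> r / ?K" using r K by (simp add: \<phi>_def)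
  moreover have "continuous_on {?q0..1} (\<phi> p)"
    by (rule continuous_on_subset[OF continuous_on_\<phi>]) (use q0(1) in auto)
  ultimately obtain q where q: "?q0 \<le> q" "q \<le> 1" "\<phi> p q = r / ?K"
    using IVT2'[of "\<phi> p" 1 "r / ?K" ?q0] q0 by (meson less_imp_le)
  moreover have "q \<noteq> 1" using q(3) r K by (auto simp: \<phi>_def)
  ultimately have "q \<in> q_range p \<and> \<phi> p q = r / ?K" by (simp add: q_range_def)
  moreover have "x = y" if "x \<in> q_range p" "y \<in> q_range p" "\<phi> p x = \<phi> p y" for x y
    using that \<phi>_strict_decreasing[OF p, of x y] \<phi>_strict_decreasing[OF p, of y x]
    by (cases x y rule: linorder_cases) (auto simp: q_range_def)
  ultimately show ?thesis by metis
qed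

lemma q_E_eqI:
  assumes p: "p \<ge> 3" and \<beta>: "\<beta> > 0"
    and r: "r_minus (E / E_inf p) = r" "0 < r" "r \<le> \<beta> / beta_c_tilde p"
    and q: "q \<in> q_range p" "\<phi> p q = r / (\<beta> * sqrt (real p * (real p - 1)))"
  shows "q_E p \<beta> E = q"
proof -
  have "\<beta> * sqrt (real p * (real p - 1)) \<noteq> 0" using p \<beta> by simp
  then have eq: "sqrt 2 * beta_2 p \<beta> x = r \<longleftrightarrow> \<phi> p x = r / (\<beta> * sqrt (real p * (real p - 1)))" for x
    unfolding sqrt_2_beta_2 by (metis mult.commute nonzero_eq_divide_eq)
  show ?thesis
    unfolding q_E_def r(1) eq
    using ex1_\<phi>_eq[OF p \<beta> r(2,3)] q by (intro the1_equality) auto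
qed

section \<open>The closed form of \<open>f_TAP\<close> and its derivative in q\<close>

lemma sqrt_mult_E_inf:
  assumes "p \<ge> 3"
  shows "sqrt (real p * (real p - 1)) * E_inf p = 2 * (real p - 1)"
proof -
  have "sqrt (real p * (real p - 1)) * E_inf p = 2 * (sqrt (real p - 1) * sqrt (real p - 1))"
    unfolding E_inf_def real_sqrt_mult real_sqrt_divide using assms by (simp del: real_sqrt_mult_self)
  also have "sqrt (real p - 1) * sqrt (real p - 1) = real p - 1"
    using assms by simp
  finally show ?thesis .
qed

text \<open>Solving the equation for r gives \<open>r = \<beta> * S * (1 - q) * w\<close>, which
  trades the powers of q for rational functions of q. E and r are independent here, so one formula
  serves \<open>U_max\<close> and both regimes of \<open>U_min\<close>.\<close>

lemma f_TAP_eq: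
  assumes p: "p \<ge> 3" and \<beta>: "\<beta> > 0" and q: "q \<in> q_range p"
    and r: "\<phi> p q = r / (\<beta> * sqrt (real p * (real p - 1)))"
  shows "f_TAP p \<beta> E q = \<beta>\<^sup>2 / 2 + 1 / 2 * ln (1 - q)
          + 2 / real p * (q / (1 - q)) * (E / E_inf p) * r
          - 1 / 2 * ((real p + q / (1 - q)) / (real p * (real p - 1))) * (q / (1 - q)) * r\<^sup>2"
proof -
  let ?q0 = "(real p - 2) / real p"
  define w S where "w = q powr ((real p - 2) / 2)" and "S = sqrt (real p * (real p - 1))"
  have "?q0 > 0" using p by simp
  then have q01: "0 < q" "q < 1" using q by (auto simp: q_range_def)
  have S: "S > 0" "S\<^sup>2 = real p * (real p - 1)" using p by (simp_all add: S_def)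
  have rw: "r = \<beta> * S * (1 - q) * w"
    using r \<beta> S(1) unfolding \<phi>_def w_def[symmetric] S_def[symmetric] by (simp add: field_simps)
  have E: "E_inf p = 2 * (real p - 1) / S"
    using sqrt_mult_E_inf[OF p] S(1) unfolding S_def[symmetric] by (simp add: field_simps)
  define m where "m = p - 2"
  have m: "p = m + 2" using p by (simp add: m_def)
  define u P where "u = 1 - q" and "P = real p - 1"
  have uP: "u > 0" "P > 0" using p q01 by (simp_all add: u_def P_def)
  have w2: "q ^ (p - 1) = q * w\<^sup>2" "q ^ p = q\<^sup>2 * w\<^sup>2"
    using powr_half_square[of p q, folded w_def] q01 m by (simp_all add: power2_eq_square)
  \<comment> \<open>The energy term: r and \<open>1 / E_inf p\<close> each contribute a factor S,
    and \<open>S\<^sup>2\<close> cancels \<open>p * (p - 1)\<close>.\<close>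
  have e1: "2 / real p * (q / (1 - q)) * (E / E_inf p) * r = \<beta> * (q * w * E)"
  proof -
    have "2 / real p * (q / (1 - q)) * (E / E_inf p) * r =
        S\<^sup>2 / (real p * (real p - 1)) * (\<beta> * (q * w * E))"
      unfolding rw E u_def[symmetric] P_def[symmetric]
      using uP p S(1) by (simp add: field_simps power2_eq_square)
    then show ?thesis using S p by simp
  qed
  \<comment> \<open>The correction term: \<open>p * (1 - q) * q ^ (p - 1) + q ^ p\<close> equals
    \<open>N * (q * w\<^sup>2)\<close> with \<open>N = p * u + q\<close>.\<close>
  have e2: "1 / 2 * ((real p + q / (1 - q)) / (real p * (real p - 1))) * (q / (1 - q)) * r\<^sup>2
      = \<beta>\<^sup>2 / 2 * (real p * (1 - q) * (q * w\<^sup>2) + q\<^sup>2 * w\<^sup>2)"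
  proof -
    define N M where "N = real p * u + q" and "M = real p * P"
    have "M > 0" using p uP by (simp add: M_def)
    have r2: "r\<^sup>2 = \<beta>\<^sup>2 * M * u\<^sup>2 * w\<^sup>2"
      by (simp add: rw power_mult_distrib S M_def u_def P_def)
    have N: "real p + q / u = N / u"
      using uP by (simp add: N_def field_simps)
    have "1 / 2 * (N / u / M) * (q / u) * r\<^sup>2 = \<beta>\<^sup>2 / 2 * (N * (q * w\<^sup>2))"
      unfolding r2 using uP \<open>M > 0\<close> by (simp add: power2_eq_square)
    also have "N * (q * w\<^sup>2) = real p * u * (q * w\<^sup>2) + q\<^sup>2 * w\<^sup>2"
      by (simp add: N_def algebra_simps power2_eq_square)
    finally show ?thesis
      unfolding u_def[symmetric] P_def[symmetric] N M_def[symmetric] .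
  qed
  show ?thesis
    unfolding f_TAP_def h_TAP_def powr_half_Suc[OF q01(1)] w_def[symmetric] w2 e1 e2
    by (simp add: algebra_simps)
qed

text \<open>The energy, the logarithm and the correction contribute \<open>\<eta> * z\<close>,
  \<open>- 1 / 2\<close> and \<open>- z\<^sup>2 / 2\<close>, each over \<open>1 - q\<close>.\<close>

lemma f_TAP_deriv:
  assumes p: "p \<ge> 3" and q: "0 < q" "q < 1" and \<eta>: "\<eta> = E / E_inf p"
    and z: "z = sqrt 2 * beta_2 p \<beta> q"
  shows "(f_TAP p \<beta> E has_real_derivative - (z\<^sup>2 - 2 * \<eta> * z + 1) / (2 * (1 - q))) (at q)"
proof -
  define w S where "w = q powr ((real p - 2) / 2)" and "S = sqrt (real p * (real p - 1))"
  have S: "S > 0" "S\<^sup>2 = real p * (real p - 1)" using p by (simp_all add: S_def)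
  have zw: "z = \<beta> * S * (1 - q) * w"
    unfolding z sqrt_2_beta_2 by (simp add: \<phi>_def w_def S_def)
  have E: "E_inf p = 2 * (real p - 1) / S"
    using sqrt_mult_E_inf[OF p] S(1) unfolding S_def[symmetric] by (simp add: field_simps)
  define m where "m = p - 2"
  have m: "p = m + 2" using p by (simp add: m_def)
  have w2: "q ^ (p - 2) = w\<^sup>2" "q ^ (p - 1) = q * w\<^sup>2"
    using powr_half_square[of p q, folded w_def] q m by simp_all
  have w1: "q powr (real p / 2 - 1) = w"
    by (simp add: w_def diff_divide_distrib)
  have "(f_TAP p \<beta> E has_real_derivative
      \<beta> * (real p / 2 * q powr (real p / 2 - 1) * E) - 1 / (2 * (1 - q))
      + \<beta>\<^sup>2 / 2 * (- real p * ((1 - q) * (real (p - 1) * q ^ (p - 2)) - q ^ (p - 1))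
        - real p * q ^ (p - 1))) (at q)"
  proof -
    \<comment> \<open>The powers of q stay abstract as A, B, C, so the shape of the derivative is
      settled independently of the exponents.\<close>
    have comb: "((\<lambda>q. \<beta> * (C q * E) + 1 / 2 * ln (1 - q) + \<beta>\<^sup>2 / 2 * (1 - real p * (1 - q) * A q - B q))
        has_real_derivative \<beta> * (C' * E) - 1 / (2 * (1 - q))
          + \<beta>\<^sup>2 / 2 * (- real p * ((1 - q) * A' - A q) - B')) (at q)"
      if "(A has_real_derivative A') (at q)" "(B has_real_derivative B') (at q)"
        "(C has_real_derivative C') (at q)" for A B C A' B' C'
    proof -
      have "((\<lambda>q. ln (1 - q)) has_real_derivative - 1 / (1 - q)) (at q)"
        using q by (auto intro!: derivative_eq_intros)
      moreover have "((\<lambda>q. (1 - q) * A q) has_real_derivative (1 - q) * A' - A q) (at q)"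
        using that(1) by (auto intro!: derivative_eq_intros)
      ultimately have "((\<lambda>q. \<beta> * (C q * E) + 1 / 2 * ln (1 - q)
          + \<beta>\<^sup>2 / 2 * (1 - real p * ((1 - q) * A q) - B q)) has_real_derivative
          \<beta> * (C' * E) + 1 / 2 * (- 1 / (1 - q))
          + \<beta>\<^sup>2 / 2 * (0 - real p * ((1 - q) * A' - A q) - B')) (at q)"
        by (intro DERIV_add DERIV_diff DERIV_cmult DERIV_cmult_right DERIV_const that)
      then show ?thesis by (simp add: mult.assoc)
    qed
    have "((\<lambda>q. q ^ (p - 1)) has_real_derivative real (p - 1) * q ^ (p - 2)) (at q)"
      using DERIV_pow[of "p - 1" q] by (simp add: numeral_2_eq_2)
    moreover have "((\<lambda>q. q ^ p) has_real_derivative real p * q ^ (p - 1)) (at q)"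
      using DERIV_pow[of p q] by simp
    moreover have "((\<lambda>q. q powr (real p / 2)) has_real_derivative
        real p / 2 * q powr (real p / 2 - 1)) (at q)"
      by (rule has_real_derivative_powr[OF q(1)])
    ultimately show ?thesis
      unfolding f_TAP_def[abs_def] h_TAP_def by (rule comb)
  qed
  moreover have "\<beta> * (real p / 2 * w * E) = \<eta> * z / (1 - q)"
  proof -
    have "\<eta> * z / (1 - q) = S\<^sup>2 / (2 * (real p - 1)) * \<beta> * w * E"
      unfolding zw E \<eta> using q p S(1) by (simp add: power2_eq_square)
    also have "S\<^sup>2 / (2 * (real p - 1)) = real p / 2"
      unfolding S(2) using p by (simp add: field_simps)
    finally show ?thesis by simp
  qed
  \<comment> \<open>The two terms \<open>p * (q * w\<^sup>2)\<close> have opposite signs and cancel;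
    only \<open>p * (p - 1) * (1 - q) * w\<^sup>2\<close> survives.\<close>
  moreover have "\<beta>\<^sup>2 / 2 * (- real p * ((1 - q) * (real (p - 1) * w\<^sup>2) - q * w\<^sup>2)
        - real p * (q * w\<^sup>2)) = - z\<^sup>2 / (2 * (1 - q))"
  proof -
    have "z\<^sup>2 = \<beta>\<^sup>2 * (real p * (real p - 1)) * (1 - q)\<^sup>2 * w\<^sup>2"
      by (simp add: zw power_mult_distrib S)
    moreover have "c * u\<^sup>2 * d / (2 * u) = c / 2 * u * d" if "u > 0" for c d u :: real
      using that by (simp add: power2_eq_square)
    from this[of "1 - q"] calculation have "z\<^sup>2 / (2 * (1 - q)) = \<beta>\<^sup>2 * (real p * (real p - 1)) / 2 * (1 - q) * w\<^sup>2"
      using q by (simp only: diff_gt_0_iff_gt)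
    then show ?thesis using p by (simp add: of_nat_diff algebra_simps)
  qed
  ultimately have "(f_TAP p \<beta> E has_real_derivative
      \<eta> * z / (1 - q) - 1 / (2 * (1 - q)) + - z\<^sup>2 / (2 * (1 - q))) (at q)"
    by (simp only: w1 w2)
  moreover have "\<eta> * z / (1 - q) - 1 / (2 * (1 - q)) + - z\<^sup>2 / (2 * (1 - q))
      = - (z\<^sup>2 - 2 * \<eta> * z + 1) / (2 * (1 - q))"
  proof -
    have "a / u - 1 / (2 * u) + - b / (2 * u) = - (b - 2 * a + 1) / (2 * u)" if "u > 0" for a b u :: real
      using that by (simp add: field_simps)
    from this[of "1 - q" "\<eta> * z" "z\<^sup>2"] show ?thesis
      using q by (simp only: diff_gt_0_iff_gt mult.assoc)
  qed
  ultimately show ?thesis by (simp only:)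
qed

section \<open>Maximality of the critical point where z is at most 1\<close>

lemma f_TAP_le_at_critical:
  assumes p: "p \<ge> 3" and \<beta>: "\<beta> > 0" and \<eta>: "\<eta> = E / E_inf p" "\<eta> \<ge> 1"
    and Q: "Q \<in> q_range p" "sqrt 2 * beta_2 p \<beta> Q = r_minus \<eta>"
    and x: "x \<in> q_range p" "sqrt 2 * beta_2 p \<beta> x \<le> 1"
  shows "f_TAP p \<beta> E x \<le> f_TAP p \<beta> E Q"
proof -
  define r where "r = r_minus \<eta>"
  define z where "z q = sqrt 2 * beta_2 p \<beta> q" for q
  have r0: "r > 0" using r_minus_pos \<eta> by (simp add: r_def)
  have q0: "(real p - 2) / real p > 0" using p by simp
  have mono: "z b \<le> z a" if "a \<in> q_range p" "a \<le> b" "b < 1" for a b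
  proof (cases "a = b")
    case False
    then have "\<phi> p b \<le> \<phi> p a"
      using \<phi>_strict_decreasing[OF p, of a b] that by (auto simp: q_range_def)
    then show ?thesis using \<beta> p by (simp add: z_def sqrt_2_beta_2 mult_left_mono)
  qed auto
  have der: "(f_TAP p \<beta> E has_real_derivative (z q - r) * (1 - r * z q) / (2 * (1 - q) * r)) (at q)"
    if "q \<in> q_range p" for q
  proof -
    have q: "0 < q" "q < 1" using that q0 by (auto simp: q_range_def)
    \<comment> \<open>Replacing \<eta> by r factors the quadratic through its roots r and
      \<open>1 / r\<close>.\<close>
    have "2 * \<eta> * r = r\<^sup>2 + 1" using r_minus_quadratic[OF \<eta>(2)] unfolding r_def by linarith
    then have *: "r * - ((z q)\<^sup>2 - 2 * \<eta> * z q + 1) = (z q - r) * (1 - r * z q)"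
      by algebra
    have "- ((z q)\<^sup>2 - 2 * \<eta> * z q + 1) = (z q - r) * (1 - r * z q) / r"
      unfolding *[symmetric] using r0 by (subst nonzero_mult_div_cancel_left) auto
    then have "- ((z q)\<^sup>2 - 2 * \<eta> * z q + 1) / (2 * (1 - q)) =
        (z q - r) * (1 - r * z q) / (2 * (1 - q) * r)"
      by (simp only: divide_divide_eq_left mult.commute)
    then show ?thesis
      using f_TAP_deriv[OF p q \<eta>(1), of "z q" \<beta>] by (simp add: z_def)
  qed
  have r1: "r \<le> 1"
    using r_minus_less_1[of \<eta>] \<eta> by (cases "\<eta> = 1") (auto simp: r_def r_minus_def)
  show ?thesis
  proof (cases "x \<le> Q")
    case True
    show ?thesis
    proof (rule DERIV_nonneg_imp_nondecreasing[OF True])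
      fix q assume q: "x \<le> q" "q \<le> Q"
      have qr: "q \<in> q_range p" using q x Q by (auto simp: q_range_def)
      have "r \<le> z q" using mono[OF qr q(2)] Q by (simp add: r_def z_def q_range_def)
      \<comment> \<open>Since z decreases, the constraint at x holds on all of
        \<open>[x, Q]\<close>. It keeps z below the larger root \<open>1 / r\<close>, so the
        derivative is nonnegative.\<close>
      moreover have "z x \<le> 1" using x by (simp add: z_def)
      then have "z q \<le> 1" using mono[OF x(1) q(1)] qr by (simp add: q_range_def)
      ultimately have "0 \<le> (z q - r) * (1 - r * z q) / (2 * (1 - q) * r)"
        using r0 r1 qr by (intro divide_nonneg_nonneg mult_nonneg_nonneg)
          (auto simp: q_range_def mult_le_one)
      then show "\<exists>y. (f_TAP p \<beta> E has_real_derivative y) (at q) \<and> 0 \<le> y"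
        using der[OF qr] by blast
    qed
  next
    case False
    then have "Q \<le> x" by simp
    then show ?thesis
    proof (rule DERIV_nonpos_imp_nonincreasing)
      fix q assume q: "Q \<le> q" "q \<le> x"
      have qr: "q \<in> q_range p" using q x Q by (auto simp: q_range_def)
      \<comment> \<open>To the right of Q, z lies between 0 and the smaller root, so the derivative
        is nonpositive.\<close>
      have zr: "z q \<le> r" using mono[OF Q(1) q(1)] qr Q by (simp add: r_def z_def q_range_def)
      have "0 \<le> z q" using \<beta> p qr by (simp add: z_def beta_2_def q_range_def)
      then have "r * z q \<le> 1" using r0 r1 zr by (intro mult_le_one) auto
      then have "(z q - r) * (1 - r * z q) / (2 * (1 - q) * r) \<le> 0"
        using r0 zr qr by (intro divide_nonpos_nonneg mult_nonpos_nonneg) (auto simp: q_range_def)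
      then show "\<exists>y. (f_TAP p \<beta> E has_real_derivative y) (at q) \<and> y \<le> 0"
        using der[OF qr] by blast
    qed
  qed
qed

section \<open>The two regimes of \<open>U_min\<close>\<close>

lemma U_min_low_temperature:
  assumes p: "p \<ge> 3" and \<beta>: "\<beta> \<ge> beta_c_tilde p"
    and q: "q \<in> q_range p" "\<phi> p q = 1 / (\<beta> * sqrt (real p * (real p - 1)))"
  shows "U_min p \<beta> = \<beta>\<^sup>2 / 2 + 1 / 2 * ln (1 - q)
          + q * (3 * real p * (1 - q) + 3 * q - 4) / (2 * real p * (real p - 1) * (1 - q)\<^sup>2)"
proof -
  have bc: "beta_c_tilde p > 0" by (rule beta_c_tilde_pos[OF p])
  have \<beta>0: "\<beta> > 0" using bc \<beta> by linarith
  \<comment> \<open>At \<open>\<beta> = beta_c_tilde p\<close> the other branch of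
    \<open>E_min\<close> applies and gives the same value.\<close>
  have Emin: "E_min p \<beta> = E_inf p" using \<beta> bc by (auto simp: E_min_def)
  have "q_E p \<beta> (E_inf p) = q"
    by (rule q_E_eqI[OF p \<beta>0 _ _ _ q]) (use \<beta> bc E_inf_pos[OF p] in \<open>auto simp: r_minus_def\<close>)
  then have "U_min p \<beta> = f_TAP p \<beta> (E_inf p) q" by (simp add: U_min_def Emin)
  also note f_TAP_eq[OF p \<beta>0 q]
  finally have U: "U_min p \<beta> = \<beta>\<^sup>2 / 2 + 1 / 2 * ln (1 - q) + (2 / real p * (q / (1 - q))
      - 1 / 2 * ((real p + q / (1 - q)) / (real p * (real p - 1))) * (q / (1 - q)))"
    using E_inf_pos[OF p] by simp
  define u P where "u = 1 - q" and "P = real p - 1"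
  have uP: "u > 0" "P > 0" "real p > 0" using p q by (simp_all add: u_def P_def q_range_def)
  have "2 / real p * (q / u) = q * (4 * P * u) / (2 * real p * P * u\<^sup>2)"
    using uP by (simp add: power2_eq_square)
  moreover have "1 / 2 * ((real p + q / u) / (real p * P)) * (q / u)
      = q * (real p * u + q) / (2 * real p * P * u\<^sup>2)"
  proof -
    have "real p + q / u = (real p * u + q) / u" using uP by (simp add: add_divide_distrib)
    then show ?thesis by (simp add: power2_eq_square mult.assoc mult.left_commute mult.commute)
  qed
  \<comment> \<open>Over the common denominator, \<open>4 * P * u = 4 * p * u + 4 * q - 4\<close>
    produces the numerator of the claim.\<close>
  moreover have "q * (4 * P * u) - q * (real p * u + q) = q * (3 * real p * u + 3 * q - 4)"
    by (simp add: u_def P_def algebra_simps)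
  ultimately have "2 / real p * (q / u) - 1 / 2 * ((real p + q / u) / (real p * P)) * (q / u)
      = q * (3 * real p * u + 3 * q - 4) / (2 * real p * P * u\<^sup>2)"
    by (simp only: diff_divide_distrib[symmetric])
  then show ?thesis using U by (simp only: u_def P_def)
qed

text \<open>Here \<open>r_minus (E_min p \<beta> / E_inf p)\<close> is
  \<open>\<beta> / beta_c_tilde p\<close>, the value of z at the left end of \<open>q_range\<close>.
  So \<open>q_E\<close> is that end point, where \<open>1 - q = 2 / p\<close>.\<close>

lemma U_min_high_temperature:
  assumes p: "p \<ge> 3" and \<beta>: "0 < \<beta>" "\<beta> \<le> beta_c_tilde p"
  shows "U_min p \<beta> = \<beta>\<^sup>2 / 2 + 1 / 2 * ln (2 / real p)
          + (real p - 2) / (8 * real p)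
            * (4 + \<beta>\<^sup>2 / (beta_c_tilde p)\<^sup>2 * ((real p - 2) / (real p - 1)))"
proof -
  let ?q0 = "(real p - 2) / real p" and ?S = "sqrt (real p * (real p - 1))"
  define r where "r = \<beta> / beta_c_tilde p"
  have bc: "beta_c_tilde p > 0" by (rule beta_c_tilde_pos[OF p])
  have r: "0 < r" "r \<le> 1" using \<beta> bc by (simp_all add: r_def)
  have E: "E_min p \<beta> / E_inf p = (1 / r + r) / 2"
    using \<beta> E_inf_pos[OF p] by (simp add: E_min_def r_def)
  have q: "?q0 \<in> q_range p" using p by (simp add: q_range_def)
  have "?S \<noteq> 0" using p by simp
  then have \<phi>: "\<phi> p ?q0 = r / (\<beta> * ?S)"
    using arg_cong[OF sqrt_\<phi>_left_end[OF p], of "\<lambda>x. x / ?S"] \<beta>(1) by (simp add: r_def)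
  have "q_E p \<beta> (E_min p \<beta>) = ?q0"
    using r_minus_joukowsky[OF r, folded E] r(1)
    by (intro q_E_eqI[OF p \<beta>(1) _ _ _ q \<phi>]) (simp_all add: r_def)
  then have "U_min p \<beta> = f_TAP p \<beta> (E_min p \<beta>) ?q0" by (simp add: U_min_def)
  also note f_TAP_eq[OF p \<beta>(1) q \<phi>]
  also have "1 - ?q0 = 2 / real p" using p by (simp add: field_simps)
  also have "?q0 / (2 / real p) = (real p - 2) / 2" using p by simp
  finally have U: "U_min p \<beta> = \<beta>\<^sup>2 / 2 + 1 / 2 * ln (2 / real p)
      + (2 / real p * ((real p - 2) / 2) * ((1 / r + r) / 2) * r
      - 1 / 2 * ((real p + (real p - 2) / 2) / (real p * (real p - 1))) * ((real p - 2) / 2) * r\<^sup>2)"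
    by (simp add: E)
  define P where "P = real p - 1"
  have P: "P > 0" "real p = P + 1" using p by (simp_all add: P_def)
  have "2 / real p * ((real p - 2) / 2) * ((1 / r + r) / 2) * r
      - 1 / 2 * ((real p + (real p - 2) / 2) / (real p * (real p - 1))) * ((real p - 2) / 2) * r\<^sup>2
      = (real p - 2) / (8 * real p) * (4 + r\<^sup>2 * ((real p - 2) / (real p - 1)))"
    unfolding P(2) using P(1) r(1) by (simp add: divide_simps power2_eq_square) (simp add: algebra_simps)?
  then show ?thesis using U by (simp add: r_def power_divide)
qed

section \<open>The closed forms and the variational formula for \<open>U_max\<close>\<close>

theorem proposition7p1:
  fixes p :: nat and \<beta> :: real
  assumes "p \<ge> 3" and "\<beta> \<ge> beta_c p"
  shows
    "(beta_c p \<le> \<beta> \<and> \<beta> \<le> beta_c_tilde p \<longrightarrow>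
        U_min p \<beta> =
          \<beta>\<^sup>2 / 2 + 1 / 2 * ln (2 / real p)
          + (real p - 2) / (8 * real p)
            * (4 + \<beta>\<^sup>2 / (beta_c_tilde p)\<^sup>2 * ((real p - 2) / (real p - 1)))) \<and>
     (\<beta> \<ge> beta_c_tilde p \<longrightarrow>
        (\<exists>!q. q \<in> q_range p \<and>
           (1 - q) * q powr ((real p - 2) / 2) = 1 / (\<beta> * sqrt (real p * (real p - 1)))) \<and>
        (\<forall>q. q \<in> q_range p \<and>
           (1 - q) * q powr ((real p - 2) / 2) = 1 / (\<beta> * sqrt (real p * (real p - 1))) \<longrightarrow>
           U_min p \<beta> =
             \<beta>\<^sup>2 / 2 + 1 / 2 * ln (1 - q)
             + q * (3 * real p * (1 - q) + 3 * q - 4)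
               / (2 * real p * (real p - 1) * (1 - q)\<^sup>2))) \<and>
     (\<exists>!q. q \<in> q_range p \<and>
        (1 - q) * q powr ((real p - 2) / 2) = r_bar p / (\<beta> * sqrt (real p * (real p - 1)))) \<and>
     (\<forall>q. q \<in> q_range p \<and>
        (1 - q) * q powr ((real p - 2) / 2) = r_bar p / (\<beta> * sqrt (real p * (real p - 1))) \<longrightarrow>
        U_max p \<beta> =
          \<beta>\<^sup>2 / 2 + 1 / 2 * ln (1 - q)
          + 2 / real p * (q / (1 - q)) * (E_0 p / E_inf p) * r_bar p
          - 1 / 2 * ((real p + q / (1 - q)) / (real p * (real p - 1)))
            * (q / (1 - q)) * (r_bar p)\<^sup>2) \<and>
     {q \<in> q_range p. sqrt 2 * beta_2 p \<beta> q \<le> 1} \<noteq> {} \<and>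
     bdd_above ((\<lambda>q. h_TAP p \<beta> (q powr (real p / 2) * E_0 p) q)
       ` {q \<in> q_range p. sqrt 2 * beta_2 p \<beta> q \<le> 1}) \<and>
     U_max p \<beta> =
       (SUP q \<in> {q \<in> q_range p. sqrt 2 * beta_2 p \<beta> q \<le> 1}.
          h_TAP p \<beta> (q powr (real p / 2) * E_0 p) q)"
proof -
  note p = \<open>p \<ge> 3\<close>
  let ?K = "\<beta> * sqrt (real p * (real p - 1))"
  let ?A = "{q \<in> q_range p. sqrt 2 * beta_2 p \<beta> q \<le> 1}"
  define \<eta> where "\<eta> = E_0 p / E_inf p"
  have \<eta>: "\<eta> > 1" using E_0_gt_E_inf[OF p] E_inf_pos[OF p] by (simp add: \<eta>_def)
  have r: "0 < r_bar p" "r_bar p < 1"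
    using r_minus_pos r_minus_less_1 \<eta> by (simp_all add: r_bar_def \<eta>_def)
  have bc: "beta_c_tilde p > 0" by (rule beta_c_tilde_pos[OF p])
  have \<beta>0: "\<beta> > 0"
    using assms(2) r(1) bc by (auto simp: beta_c_def intro: less_le_trans[rotated])
  \<comment> \<open>This is \<open>\<beta> \<ge> beta_c p\<close> rewritten as the solvability
    condition of \<open>ex1_\<phi>_eq\<close>.\<close>
  have r_le: "r_bar p \<le> \<beta> / beta_c_tilde p"
    using assms(2) bc by (simp add: beta_c_def field_simps)
  note ex = ex1_\<phi>_eq[OF p \<beta>0 r(1) r_le]
  then obtain Q where Q: "Q \<in> q_range p" "\<phi> p Q = r_bar p / ?K" by blast
  have U_max: "U_max p \<beta> = f_TAP p \<beta> (E_0 p) q" if "q \<in> q_range p" "\<phi> p q = r_bar p / ?K" for q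
    using q_E_eqI[OF p \<beta>0 r_bar_def[symmetric] r(1) r_le that] by (simp add: U_max_def)
  have "?K \<noteq> 0" using \<beta>0 p by simp
  then have zQ: "sqrt 2 * beta_2 p \<beta> Q = r_bar p"
    unfolding sqrt_2_beta_2 Q(2) by (metis nonzero_mult_div_cancel_left times_divide_eq_right)
  \<comment> \<open>As \<open>r_bar p < 1\<close>, the critical point satisfies the constraint; the
    supremum is therefore attained at Q.\<close>
  then have QA: "Q \<in> ?A" using Q r by simp
  have le: "f_TAP p \<beta> (E_0 p) x \<le> f_TAP p \<beta> (E_0 p) Q" if "x \<in> ?A" for x
    using f_TAP_le_at_critical[OF p \<beta>0 \<eta>_def _ Q(1), of x] that zQ \<eta> by (simp add: r_bar_def \<eta>_def)
  have bdd: "bdd_above (f_TAP p \<beta> (E_0 p) ` ?A)"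
    using le by (intro bdd_aboveI2)
  have "(SUP q \<in> ?A. f_TAP p \<beta> (E_0 p) q) = f_TAP p \<beta> (E_0 p) Q"
    using QA le by (intro cSup_eq_maximum) auto
  then have sup: "U_max p \<beta> = (SUP q \<in> ?A. f_TAP p \<beta> (E_0 p) q)"
    using U_max[OF Q] by simp
  show ?thesis
    unfolding \<phi>_def[symmetric] f_TAP_def[symmetric]
  proof (intro conjI impI allI, goal_cases)
    case 1
    then show ?case using U_min_high_temperature[OF p \<beta>0] by blast
  next
    case 2
    then have "1 \<le> \<beta> / beta_c_tilde p" using bc by simp
    then show ?case by (intro ex1_\<phi>_eq[OF p \<beta>0]) simp_all
  next
    case (3 q)
    then show ?case using U_min_low_temperature[OF p] by blast
  next
    case 4
    show ?case by (rule ex)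
  next
    case (5 q)
    then show ?case using U_max[of q] f_TAP_eq[OF p \<beta>0, of q "r_bar p" "E_0 p"] by (simp only:)
  next
    case 6
    show ?case using QA by blast
  next
    case 7
    show ?case by (rule bdd)
  next
    case 8
    show ?case by (rule sup)
  qed
qed

end
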